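(* Place $n$ sensors on $[0,\infty)$ at the first $n$ arrival times $X_1<\dots<X_n$ of a homogeneous Poisson process on $[0,\infty)$ with rate $n$. Then any sensor displacement algorithm which solves the $\left(\frac1n,\frac1n\right)$-interference problem requires expected $1$-total movement of at least $\Omega(\sqrt n)$.
   Context: A sensor displacement algorithm assigns to each sensor (as a function of the initial positions) a final position in $[0,\infty)$. For $0<s\le v$, it solves the $(s,v)$-interference problem if, in the final configuration, every two consecutive sensors (consecutive in the order of final positions) are at distance at least $s$ and at most $v$. If the $i$-th sensor is displaced by a distance $|m(i)|$, the $1$-total movement is $\sum_{i=1}^n|m(i)|$. Asymptotics are as $n\to\infty$. *)

theory Defs
  imports "HOL-Probability.Probability"
begin

definition arrivals_in :: "(nat \<Rightarrow> 'a \<Rightarrow> real) \<Rightarrow> real \<Rightarrow> real \<Rightarrow> 'a \<Rightarrow> nat" where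
  "arrivals_in X s t \<omega> = card {i. s < X i \<omega> \<and> X i \<omega> \<le> t}"

(* Indices start at 0: X i is the (i+1)-st arrival time.  Divergence of the arrival times makes
   the set counted by arrivals_in finite almost surely, so that card does not silently
   return 0 on an infinite set. *)
definition poisson_arrival_times :: "'a measure \<Rightarrow> real \<Rightarrow> (nat \<Rightarrow> 'a \<Rightarrow> real) \<Rightarrow> bool" where
  "poisson_arrival_times M rate X \<longleftrightarrow>
     prob_space M \<and> 0 < rate \<and>
     (\<forall>i. X i \<in> borel_measurable M) \<and>
     (AE \<omega> in M. 0 < X 0 \<omega> \<and> strict_mono (\<lambda>i. X i \<omega>) \<and>
                 filterlim (\<lambda>i. X i \<omega>) at_top sequentially) \<and>
     (\<forall>s t. 0 \<le> s \<and> s < t \<longrightarrow>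
        arrivals_in X s t \<in> measurable M (count_space UNIV) \<and>
        distr M (count_space UNIV) (arrivals_in X s t) = measure_pmf (poisson_pmf (rate * (t - s)))) \<and>
     (\<forall>(u :: nat \<Rightarrow> real) m. 0 \<le> u 0 \<and> strict_mono u \<longrightarrow>
        prob_space.indep_vars M (\<lambda>_. count_space UNIV)
          (\<lambda>k. arrivals_in X (u k) (u (Suc k))) {..<m})"

(* The list records the positions of the n sensors, the sensors being numbered in the order
   of their initial positions. *)
definition initial_placement :: "nat \<Rightarrow> real list \<Rightarrow> bool" where
  "initial_placement n xs \<longleftrightarrow> length xs = n \<and> set xs \<subseteq> {0..} \<and> sorted_wrt (<) xs"

(* A xs ! i is the final position of sensor i; the algorithm may change the order of the
   sensors.  Outside the initial placements of n sensors A is irrelevant. *)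
definition displacement_algorithm :: "nat \<Rightarrow> (real list \<Rightarrow> real list) \<Rightarrow> bool" where
  "displacement_algorithm n A \<longleftrightarrow>
     (\<forall>xs. initial_placement n xs \<longrightarrow> length (A xs) = n \<and> set (A xs) \<subseteq> {0..})"

definition consecutive_dists_between :: "real \<Rightarrow> real \<Rightarrow> real list \<Rightarrow> bool" where
  "consecutive_dists_between s v ys \<longleftrightarrow>
     (\<forall>i. Suc i < length ys \<longrightarrow>
        s \<le> \<bar>sort ys ! Suc i - sort ys ! i\<bar> \<and> \<bar>sort ys ! Suc i - sort ys ! i\<bar> \<le> v)"

definition solves_interference :: "nat \<Rightarrow> real \<Rightarrow> real \<Rightarrow> (real list \<Rightarrow> real list) \<Rightarrow> bool" where
  "solves_interference n s v A \<longleftrightarrow>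
     0 < s \<and> s \<le> v \<and> displacement_algorithm n A \<and>
     (\<forall>xs. initial_placement n xs \<longrightarrow> consecutive_dists_between s v (A xs))"

definition total_movement :: "real list \<Rightarrow> real list \<Rightarrow> real" where
  "total_movement xs ys = (\<Sum>i<length xs. \<bar>ys ! i - xs ! i\<bar>)"

(* A Lebesgue integral with values in [0, \<infinity>]: the expectation may be infinite, and A is not
   required to be measurable.  For a non-measurable cost the integral is the lower integral
   (a supremum over simple functions below the cost), so lower bounds remain meaningful. *)
definition expected_movement ::
    "'a measure \<Rightarrow> nat \<Rightarrow> (nat \<Rightarrow> 'a \<Rightarrow> real) \<Rightarrow> (real list \<Rightarrow> real list) \<Rightarrow> ennreal" where
  "expected_movement M n X A =
     (\<integral>\<^sup>+ \<omega>. (let xs = map (\<lambda>i. X i \<omega>) [0..<n] in ennreal (total_movement xs (A xs))) \<partial>M)"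

end

theory Submission
  imports Defs
begin

text \<open>
  Fix a window length h = k/n with k = n div 4.  In the final configuration every window
  (t, t + h] contains at most k sensors, because these are at least 1/n apart, no matter where
  the configuration starts and how the sensors are permuted.  A sensor which has to leave the
  window moves, and the measure of the set of t for which it leaves is at most its displacement.
  Hence the movement is at least the integral over t in [0, h] of the initial excess over k in
  the window.  Up to the truncation to the first n arrivals this excess is the positive part of
  Z - k with Z Poisson distributed of mean k; its expectation is k^(k+1) exp (-k) / k! by
  telescoping, and hence at least of order sqrt k.  The truncation costs at most 1, since at most
  (N - n)^+ of the arrivals up to time 1/2 are dropped, where N is Poisson of mean n/2.
\<close>

subsection \<open>Poisson estimates\<close>

text \<open>Equality holds at \<open>k = 1\<close>. Passing from k to k + 1 multiplies the
  right-hand side by (k + 1) (1 + 1/k)^(k + 1/2) / e, so the induction needs only (1 + 1/k)^(k +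
  1/2) \<ge> e.\<close>

lemma fact_le_Stirling:
  fixes k :: nat
  assumes "1 \<le> k"
  shows "fact k \<le> exp 1 * sqrt k * real k ^ k * exp (- real k)"
  using assms
proof (induction k rule: dec_induct)
  case base
  then show ?case by (simp flip: exp_add)
next
  case (step k)
  define x where "x = real k"
  have x: "1 \<le> x" using step by (simp add: x_def)
  \<comment> \<open>Midpoint bound for the integral of the convex function 1/y over
    [x, x + 1].\<close>
  have "2 / (2 * x + 1) \<le> ln (x + 1) - ln x"
  proof -
    have "2 * (x + 1 - x) / (x + (x + 1)) = 2 / (2 * x + 1)" by simp
    then show ?thesis using ln_inverse_approx_ge[of x "x + 1"] x by (metis less_add_one less_le_trans zero_less_one)
  qed
  then have "2 / (2 * x + 1) * (x + 1/2) \<le> (ln (x + 1) - ln x) * (x + 1/2)"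
    using x by (intro mult_right_mono) auto
  moreover have "2 / (2 * x + 1) * (x + 1/2) = 1" using x by (simp add: field_simps)
  ultimately have "1 + (x + 1/2) * ln x \<le> (x + 1/2) * ln (x + 1)"
    by (simp add: algebra_simps)
  then have "exp (1 + (x + 1/2) * ln x) \<le> exp ((x + 1/2) * ln (x + 1))"
    by simp
  then have "exp 1 * (x powr x * x powr (1/2)) \<le> (x + 1) powr x * (x + 1) powr (1/2)"
    using x by (simp add: powr_def exp_add algebra_simps)
  then have key: "exp 1 * (x ^ k * sqrt x) \<le> (x + 1) ^ k * sqrt (x + 1)"
    using x by (simp add: powr_half_sqrt powr_realpow x_def add.commute)
  have "fact (Suc k) = (x + 1) * fact k" by (simp add: x_def)
  also have "\<dots> \<le> (x + 1) * (exp 1 * sqrt x * x ^ k * exp (- x))"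
    using step.IH x by (intro mult_left_mono) (auto simp: x_def)
  also have "\<dots> = (x + 1) * exp (- x) * (exp 1 * (x ^ k * sqrt x))" by (simp add: mult_ac)
  also have "\<dots> \<le> (x + 1) * exp (- x) * ((x + 1) ^ k * sqrt (x + 1))"
    using key x by (intro mult_left_mono) auto
  also have "\<dots> = exp 1 * sqrt (x + 1) * (x + 1) ^ Suc k * exp (- (x + 1))"
    by (simp add: exp_diff exp_minus field_simps)
  finally show ?case by (simp add: x_def add.commute)
qed

lemma nn_integral_poisson_pmf_eqI:
  assumes "0 < rate" and "\<And>j. 0 \<le> f j"
    and "(\<lambda>j. rate ^ j / fact j * exp (- rate) * f j) sums x"
  shows "(\<integral>\<^sup>+ j. ennreal (f j) \<partial>measure_pmf (poisson_pmf rate)) = ennreal x"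
proof -
  have "(\<integral>\<^sup>+ j. ennreal (f j) \<partial>measure_pmf (poisson_pmf rate)) =
      (\<Sum>j. ennreal (rate ^ j / fact j * exp (- rate) * f j))"
    unfolding nn_integral_measure_pmf nn_integral_count_space_nat
    using assms(1,2) by (intro suminf_cong) (simp flip: ennreal_mult'')
  also have "\<dots> = ennreal x"
    using assms by (intro suminf_ennreal_eq) auto
  finally show ?thesis .
qed

text \<open>With u_j = k^j / j! one has (j - k) u_j = k (u_(j-1) - u_j), so the sum over j > k
  telescopes to k u_k. The coercion \<open>ennreal\<close> sends negative reals to 0, hence the
  integrand is the positive part.\<close>

lemma nn_integral_poisson_pos_part:
  assumes "1 \<le> k"
  shows "(\<integral>\<^sup>+ j. ennreal (real j - real k) \<partial>measure_pmf (poisson_pmf (real k))) =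
    ennreal (real k * (real k ^ k / fact k) * exp (- real k))"
proof -
  define u where "u j = real k ^ j / fact j" for j
  have u: "u \<longlonglongrightarrow> 0"
    unfolding u_def using summable_exp[of "real k"]
    by (intro summable_LIMSEQ_zero) (simp add: field_simps)
  have "(\<lambda>i. u (i + k) - u (Suc i + k)) sums (u (0 + k) - 0)"
    using LIMSEQ_ignore_initial_segment[OF u, of k] by (intro telescope_sums')
  then have "(\<lambda>i. real k * exp (- real k) * (u (i + k) - u (Suc i + k)))
      sums (real k * exp (- real k) * u k)"
    by (intro sums_mult) simp
  moreover have "real k * exp (- real k) * (u (i + k) - u (Suc i + k)) =
      u (Suc i + k) * exp (- real k) * max 0 (real (Suc i + k) - real k)" for i
  proof -
    have "u (i + k) * real k = u (Suc i + k) * real (Suc i + k)"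
      using assms by (simp add: u_def divide_simps)
    moreover have "real k * exp (- real k) * (u (i + k) - u (Suc i + k)) =
        exp (- real k) * (u (i + k) * real k - u (Suc i + k) * real k)"
      by (simp add: right_diff_distrib mult_ac)
    moreover have "max 0 (real (Suc i + k) - real k) = real (Suc i + k) - real k" by simp
    ultimately show ?thesis by (simp only: right_diff_distrib mult_ac)
  qed
  ultimately have "(\<lambda>i. u (i + Suc k) * exp (- real k) * max 0 (real (i + Suc k) - real k))
      sums (real k * exp (- real k) * u k)"
    by (simp only: add_Suc add_Suc_right)
  \<comment> \<open>The telescoped series starts at j = k + 1; the terms with j \<le> k
    vanish.\<close>
  moreover have "(\<Sum>i<Suc k. u i * exp (- real k) * max 0 (real i - real k)) = 0"
    by (intro sum.neutral) auto
  ultimately have "(\<lambda>i. u i * exp (- real k) * max 0 (real i - real k))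
      sums (real k * exp (- real k) * u k)"
    using sums_iff_shift'[of "\<lambda>i. u i * exp (- real k) * max 0 (real i - real k)" "Suc k"]
    by simp
  then have "(\<integral>\<^sup>+ j. ennreal (max 0 (real j - real k)) \<partial>measure_pmf (poisson_pmf (real k))) =
      ennreal (real k * exp (- real k) * u k)"
    using assms by (intro nn_integral_poisson_pmf_eqI) (auto simp: u_def)
  then show ?thesis by (simp add: u_def mult_ac)
qed

text \<open>By the factorial bound, k^(k+1) exp (-k) / k! is at least sqrt k / e, and e \<le>
  3.\<close>

lemma nn_integral_poisson_pos_part_ge:
  assumes "1 \<le> k"
  shows "ennreal (sqrt (real k) / 3) \<le>
    (\<integral>\<^sup>+ j. ennreal (real j - real k) \<partial>measure_pmf (poisson_pmf (real k)))"
proof -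
  have "sqrt k * fact k \<le> sqrt k * (exp 1 * sqrt k * real k ^ k * exp (- real k))"
    using fact_le_Stirling[OF assms] by (intro mult_left_mono) auto
  also have "\<dots> = exp 1 * (real k * real k ^ k * exp (- real k))" by simp
  also have "\<dots> \<le> 3 * (real k * real k ^ k * exp (- real k))"
    using exp_le by (intro mult_right_mono) auto
  finally have "sqrt k / 3 \<le> real k * (real k ^ k / fact k) * exp (- real k)"
    by (simp add: field_simps)
  then show ?thesis
    unfolding nn_integral_poisson_pos_part[OF assms] by (rule ennreal_leI)
qed

text \<open>Exponential moment bound: the truncated difference \<open>j - n\<close> is at most 2^j /
  2^n, and a Poisson variable N of mean n/2 has E 2^N = exp (n/2) \<le> 2^n.\<close>

lemma nn_integral_poisson_excess_le:
  assumes "0 < n"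
  shows "(\<integral>\<^sup>+ j. ennreal (real (j - n)) \<partial>measure_pmf (poisson_pmf (real n / 2))) \<le> 1"
proof -
  let ?r = "real n / 2"
  have "(\<lambda>j. (2 * ?r) ^ j / fact j) sums exp (2 * ?r)"
    using exp_converges[of "2 * ?r"] by (simp add: field_simps)
  then have "(\<lambda>j. exp (- ?r) / 2 ^ n * ((2 * ?r) ^ j / fact j)) sums (exp (- ?r) / 2 ^ n * exp (2 * ?r))"
    by (rule sums_mult)
  moreover have "exp (- ?r) / 2 ^ n * ((2 * ?r) ^ j / fact j) =
      ?r ^ j / fact j * exp (- ?r) * (2 ^ j / 2 ^ n)" for j
    by (simp only: power_mult_distrib) (simp add: mult_ac)
  moreover have "exp (- ?r) / 2 ^ n * exp (2 * ?r) = exp ?r / 2 ^ n"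
    by (simp flip: exp_add)
  ultimately have "(\<integral>\<^sup>+ j. ennreal (2 ^ j / 2 ^ n) \<partial>measure_pmf (poisson_pmf ?r)) = ennreal (exp ?r / 2 ^ n)"
    using assms by (intro nn_integral_poisson_pmf_eqI) auto
  also have "exp ?r \<le> 2 ^ n"
  proof -
    have "exp (1/2) \<le> (2::real)"
    proof (rule power2_le_imp_le)
      have "exp (1/2 :: real) ^ 2 = exp 1" by (simp flip: exp_of_nat_mult)
      then show "exp (1/2 :: real) ^ 2 \<le> 2 ^ 2" using exp_le by simp
    qed simp
    then have "exp (1/2 :: real) ^ n \<le> 2 ^ n" by (intro power_mono) auto
    then show ?thesis by (simp flip: exp_of_nat_mult)
  qed
  then have "ennreal (exp ?r / 2 ^ n) \<le> 1" by simp
  finally have "(\<integral>\<^sup>+ j. ennreal (2 ^ j / 2 ^ n) \<partial>measure_pmf (poisson_pmf ?r)) \<le> 1" .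
  moreover have "real (j - n) \<le> 2 ^ j / 2 ^ n" for j
  proof (cases "n \<le> j")
    case True
    have "real (j - n) \<le> 2 ^ (j - n)" by (rule of_nat_less_two_power[THEN less_imp_le])
    then show ?thesis using True by (simp add: power_diff)
  qed simp
  then have "(\<integral>\<^sup>+ j. ennreal (real (j - n)) \<partial>measure_pmf (poisson_pmf ?r)) \<le>
      (\<integral>\<^sup>+ j. ennreal (2 ^ j / 2 ^ n) \<partial>measure_pmf (poisson_pmf ?r))"
    by (intro nn_integral_mono ennreal_leI)
  ultimately show ?thesis by (rule order_trans[rotated])
qed

subsection \<open>Movement and window counts\<close>

text \<open>Sorted positions whose indices differ by d are at least d s apart, while two points of a
  half-open window of length k s are less than k s apart. The half-open form gives k here; a closed
  window could hold k + 1 points.\<close>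

lemma card_window_le:
  fixes ys :: "real list"
  assumes "consecutive_dists_between s v ys" and "0 < s"
  shows "card {i. i < length ys \<and> t < ys ! i \<and> ys ! i \<le> t + real k * s} \<le> k"
proof -
  let ?P = "\<lambda>y. t < y \<and> y \<le> t + real k * s"
  define zs where "zs = sort ys"
  have len: "length zs = length ys" by (simp add: zs_def)
  have sorted: "sorted zs" by (simp add: zs_def)
  have step: "s \<le> zs ! Suc i - zs ! i" if "Suc i < length zs" for i
    using assms(1) that sorted_nth_mono[OF sorted, of i "Suc i"] len
    unfolding consecutive_dists_between_def zs_def[symmetric] by fastforce
  have gap: "real d * s \<le> zs ! (i + d) - zs ! i" if "i + d < length zs" for i d
    using that
  proof (induction d)
    case (Suc d)
    then show ?case using step[of "i + d"] by (simp add: algebra_simps)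
  qed simp
  let ?J = "{i. i < length zs \<and> ?P (zs ! i)}"
  have "card {i. i < length ys \<and> ?P (ys ! i)} = length (filter ?P ys)"
    by (simp add: length_filter_conv_card)
  \<comment> \<open>The count depends only on the multiset of positions, so the order of the sensors
    is irrelevant.\<close>
  also have "\<dots> = length (filter ?P zs)"
    unfolding zs_def by (metis mset_filter mset_sort size_mset)
  also have "\<dots> = card ?J"
    by (simp add: length_filter_conv_card)
  also have "\<dots> \<le> k"
  proof (cases "?J = {}")
    case False
    define a where "a = Min ?J"
    have a: "a \<in> ?J" unfolding a_def using False by (intro Min_in) auto
    have "?J \<subseteq> {a..<a + k}"
    proof
      fix j assume j: "j \<in> ?J"
      have "a \<le> j" unfolding a_def using j by (intro Min_le) auto
      then have "real (j - a) * s \<le> zs ! j - zs ! a" using gap[of a "j - a"] j by simp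
      also have "\<dots> < real k * s" using a j by auto
      finally have "j - a < k" using assms(2) by simp
      then show "j \<in> {a..<a + k}" using \<open>a \<le> j\<close> by auto
    qed
    then have "card ?J \<le> card {a..<a + k}" by (intro card_mono) auto
    then show ?thesis by simp
  qed (simp only: card.empty)
  finally show ?thesis .
qed

text \<open>A point moving right can only leave through the right end, which forces t into
  [x - h, y - h]; one moving left only through the left end, which forces t into [y, x]. Both
  intervals have length |y - x|.\<close>

lemma nn_integral_window_exit_le:
  fixes x y h :: real
  shows "(\<integral>\<^sup>+ t. indicator {t. t < x \<and> x \<le> t + h \<and> \<not> (t < y \<and> y \<le> t + h)} t \<partial>lborel)
    \<le> ennreal \<bar>y - x\<bar>"
proof -
  have "(\<integral>\<^sup>+ t. indicator {t. t < x \<and> x \<le> t + h \<and> \<not> (t < y \<and> y \<le> t + h)} t \<partial>lborel)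
    \<le> (\<integral>\<^sup>+ t. indicator (if x \<le> y then {x - h..y - h} else {y..x}) t \<partial>lborel)"
    by (intro nn_integral_mono) (auto split: split_indicator)
  also have "\<dots> \<le> ennreal \<bar>y - x\<bar>" by auto
  finally show ?thesis .
qed

lemma total_movement_ge_window_excess:
  assumes "length ys = length xs" and "consecutive_dists_between s v ys" and "0 < s"
  shows "(\<integral>\<^sup>+ t. ennreal ((\<Sum>i<length xs. indicator {t<..t + real k * s} (xs ! i)) - real k) \<partial>lborel)
    \<le> ennreal (total_movement xs ys)"
proof -
  define h where "h = real k * s"
  let ?n = "length xs"
  let ?E = "\<lambda>i. {t. t < xs ! i \<and> xs ! i \<le> t + h \<and> \<not> (t < ys ! i \<and> ys ! i \<le> t + h)}"
  \<comment> \<open>\<open>?E i\<close> is the set of t whose window sensor i leaves. The initial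
    count is at most the final count, which is at most k, plus the number of leavers.\<close>
  have *: "(\<Sum>i<?n. indicator {t<..t + h} (xs ! i)) - real k \<le> (\<Sum>i<?n. indicator (?E i) t :: real)" for t
  proof -
    have "(\<Sum>i<?n. indicator {t<..t + h} (xs ! i) :: real) \<le>
        (\<Sum>i<?n. indicator {t<..t + h} (ys ! i) + indicator (?E i) t)"
      by (intro sum_mono) (auto split: split_indicator)
    moreover have "(\<Sum>i<?n. indicator {t<..t + h} (ys ! i)) =
        real (card {i. i < length ys \<and> t < ys ! i \<and> ys ! i \<le> t + h})"
      using assms(1) by (simp add: indicator_def Int_def flip: of_nat_sum)
    ultimately show ?thesis
      using card_window_le[OF assms(2,3), of t k] by (simp add: sum.distrib h_def)
  qed
  have "ennreal ((\<Sum>i<?n. indicator {t<..t + h} (xs ! i)) - real k) \<le> (\<Sum>i<?n. indicator (?E i) t)" for t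
  proof -
    have "ennreal (\<Sum>i<?n. indicator (?E i) t) = (\<Sum>i<?n. indicator (?E i) t)"
      by (subst sum_ennreal[symmetric]) (simp_all only: ennreal_indicator indicator_pos_le)
    then show ?thesis using ennreal_leI[OF *, of t] by (simp only:)
  qed
  then have "(\<integral>\<^sup>+ t. ennreal ((\<Sum>i<?n. indicator {t<..t + h} (xs ! i)) - real k) \<partial>lborel) \<le>
      (\<integral>\<^sup>+ t. (\<Sum>i<?n. indicator (?E i) t) \<partial>lborel)"
    by (intro nn_integral_mono)
  also have "\<dots> = (\<Sum>i<?n. (\<integral>\<^sup>+ t. indicator (?E i) t \<partial>lborel))"
    by (intro nn_integral_sum) measurable
  also have "\<dots> \<le> (\<Sum>i<?n. ennreal \<bar>ys ! i - xs ! i\<bar>)"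
    by (intro sum_mono nn_integral_window_exit_le)
  finally show ?thesis by (simp add: total_movement_def h_def)
qed

section \<open>Poisson windows and the expected movement\<close>

text \<open>Bounds the loss from keeping only n arrivals: an arrival in (s, t] of index at least n
  is among those up to time u, and these have exactly the indices below \<open>m\<close>. The
  subtraction of n is truncated at 0.\<close>

lemma arrivals_in_le_window_count:
  assumes "0 < X 0 \<omega>" and "strict_mono (\<lambda>i. X i \<omega>)"
    and "filterlim (\<lambda>i. X i \<omega>) at_top sequentially" and "0 \<le> s" and "t \<le> u"
  shows "real (arrivals_in X s t \<omega>) \<le>
    (\<Sum>i<n. indicator {s<..t} (X i \<omega>)) + real (arrivals_in X 0 u \<omega> - n)"
proof -
  have ex: "\<exists>i. u < X i \<omega>"
    using assms(3) eventually_happens'[OF sequentially_bot]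
    unfolding filterlim_at_top_dense by blast
  define m where "m = (LEAST i. u < X i \<omega>)"
  have mono: "X i \<omega> \<le> X j \<omega>" if "i \<le> j" for i j
    using strict_mono_mono[OF assms(2)] that by (simp add: mono_def)
  have "u < X m \<omega>" unfolding m_def using ex by (rule LeastI_ex)
  then have "i < m" if "X i \<omega> \<le> u" for i
    using that mono[of m i] by (cases "m \<le> i") auto
  moreover have "X i \<omega> \<le> u" if "i < m" for i
    using that not_less_Least unfolding m_def by fastforce
  ultimately have le_iff: "X i \<omega> \<le> u \<longleftrightarrow> i < m" for i by blast
  have "0 < X i \<omega>" for i
    using assms(1) mono[of 0 i] by simp
  then have "{i. 0 < X i \<omega> \<and> X i \<omega> \<le> u} = {..<m}"
    by (auto simp: le_iff)
  then have m: "arrivals_in X 0 u \<omega> = m" by (simp add: arrivals_in_def)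
  have "{i. s < X i \<omega> \<and> X i \<omega> \<le> t} \<subseteq> {i. i < n \<and> X i \<omega> \<in> {s<..t}} \<union> {n..<m}"
    using assms(5) le_iff by fastforce
  then have "arrivals_in X s t \<omega> \<le> card ({i. i < n \<and> X i \<omega> \<in> {s<..t}} \<union> {n..<m})"
    unfolding arrivals_in_def by (intro card_mono) auto
  also have "\<dots> \<le> card {i. i < n \<and> X i \<omega> \<in> {s<..t}} + card {n..<m}"
    by (rule card_Un_le)
  finally have "real (arrivals_in X s t \<omega>) \<le> real (card {i. i < n \<and> X i \<omega> \<in> {s<..t}}) + real (m - n)"
    by simp
  moreover have "real (card {i. i < n \<and> X i \<omega> \<in> {s<..t}}) = (\<Sum>i<n. indicator {s<..t} (X i \<omega>))"
    by (simp add: indicator_def Int_def flip: of_nat_sum)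
  ultimately show ?thesis by (simp add: m)
qed

text \<open>The full count \<open>?Z\<close> is Poisson of mean n (k/n) = k. Dropping the arrivals
  of index at least n costs at most the excess of \<open>?N\<close> over n, whose expectation is at
  most 1 because \<open>?N\<close> has mean n/2.\<close>

lemma expected_window_excess_ge:
  assumes P: "poisson_arrival_times M (real n) X" and k: "1 \<le> k" and t: "0 \<le> t"
    and u: "t + real k / real n \<le> 1/2"
  shows "ennreal (sqrt (real k) / 3 - 1) \<le>
    (\<integral>\<^sup>+ \<omega>. ennreal ((\<Sum>i<n. indicator {t<..t + real k / real n} (X i \<omega>)) - real k) \<partial>M)"
    (is "_ \<le> ?I")
proof -
  let ?h = "real k / real n"
  let ?Z = "arrivals_in X t (t + ?h)"
  let ?N = "arrivals_in X 0 (1/2)"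
  let ?S = "\<lambda>\<omega>. \<Sum>i<n. indicator {t<..t + ?h} (X i \<omega>) :: real"
  have n: "0 < n" using P by (auto simp: poisson_arrival_times_def)
  have X [measurable]: "X i \<in> borel_measurable M" for i
    using P by (auto simp: poisson_arrival_times_def)
  have distr: "arrivals_in X a b \<in> measurable M (count_space UNIV)"
    "distr M (count_space UNIV) (arrivals_in X a b) = measure_pmf (poisson_pmf (real n * (b - a)))"
    if "0 \<le> a" "a < b" for a b
    using P that by (auto simp: poisson_arrival_times_def)
  have law: "(\<integral>\<^sup>+ \<omega>. f (arrivals_in X a b \<omega>) \<partial>M) =
      (\<integral>\<^sup>+ j. f j \<partial>measure_pmf (poisson_pmf (real n * (b - a))))"
    if "0 \<le> a" "a < b" for a b and f :: "nat \<Rightarrow> ennreal"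
    using distr[OF that] nn_integral_distr[of "arrivals_in X a b" M "count_space UNIV" f] by simp
  have [measurable]: "?N \<in> measurable M (count_space UNIV)" by (rule distr) auto
  have "0 < ?h" using n k by simp
  then have "ennreal (sqrt (real k) / 3) \<le> (\<integral>\<^sup>+ \<omega>. ennreal (real (?Z \<omega>) - real k) \<partial>M)"
    using law[of t "t + ?h" "\<lambda>j. ennreal (real j - real k)"] nn_integral_poisson_pos_part_ge[OF k] t n
    by simp
  also have "\<dots> \<le> (\<integral>\<^sup>+ \<omega>. ennreal (?S \<omega> - real k) + ennreal (real (?N \<omega> - n)) \<partial>M)"
  proof (rule nn_integral_mono_AE)
    have "AE \<omega> in M. 0 < X 0 \<omega> \<and> strict_mono (\<lambda>i. X i \<omega>) \<and> filterlim (\<lambda>i. X i \<omega>) at_top sequentially"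
      using P by (auto simp: poisson_arrival_times_def)
    then show "AE \<omega> in M. ennreal (real (?Z \<omega>) - real k) \<le>
        ennreal (?S \<omega> - real k) + ennreal (real (?N \<omega> - n))"
    proof eventually_elim
      case (elim \<omega>)
      have "real (?Z \<omega>) - real k \<le> max 0 (?S \<omega> - real k) + real (?N \<omega> - n)"
        using arrivals_in_le_window_count[of X \<omega> t "t + ?h" "1/2" n] elim t u by simp
      then have "ennreal (real (?Z \<omega>) - real k) \<le> ennreal (max 0 (?S \<omega> - real k) + real (?N \<omega> - n))"
        by (rule ennreal_leI)
      then show ?case by (simp del: ennreal_of_nat_eq_real_of_nat add: ennreal_plus)
    qed
  qed
  also have "\<dots> = ?I + (\<integral>\<^sup>+ \<omega>. ennreal (real (?N \<omega> - n)) \<partial>M)"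
    by (rule nn_integral_add) measurable
  also have "\<dots> \<le> ?I + 1"
    using law[of 0 "1/2" "\<lambda>j. ennreal (real (j - n))"] nn_integral_poisson_excess_le[OF n]
    by (intro add_left_mono) simp
  finally have le: "ennreal (sqrt (real k) / 3) \<le> ?I + 1" .
  show ?thesis
  \<comment> \<open>If \<open>?I\<close> is finite, the 1 can be moved across the inequality in the
    reals; if infinite, the bound is trivial.\<close>
  proof (cases ?I)
    case (real r)
    then have "ennreal (sqrt (real k) / 3) \<le> ennreal (r + 1)" using le by simp
    then have "sqrt (real k) / 3 \<le> r + 1" using real by (subst (asm) ennreal_le_iff) auto
    then show ?thesis unfolding real by (intro ennreal_leI) auto
  qed simp
qed

lemma expected_movement_ge:
  assumes P: "poisson_arrival_times M (real n) X" and S: "solves_interference n (1 / real n) v A"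
    and k: "1 \<le> k" "4 * k \<le> n"
  shows "ennreal (real k / real n * (sqrt (real k) / 3 - 1)) \<le> expected_movement M n X A"
proof -
  let ?h = "real k / real n"
  let ?xs = "\<lambda>\<omega>. map (\<lambda>i. X i \<omega>) [0..<n]"
  let ?F = "\<lambda>t \<omega>. ennreal ((\<Sum>i<n. indicator {t<..t + ?h} (X i \<omega>)) - real k)"
  interpret prob_space M using P by (simp add: poisson_arrival_times_def)
  interpret pair_sigma_finite M lborel
    by unfold_locales
  have X [measurable]: "X i \<in> borel_measurable M" for i
    using P by (auto simp: poisson_arrival_times_def)
  have n: "0 < n" using k by simp
  have "ennreal (?h * (sqrt (real k) / 3 - 1)) = (\<integral>\<^sup>+ t. indicator {0..?h} t * ennreal (sqrt (real k) / 3 - 1) \<partial>lborel)"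
    by (subst ennreal_mult') (auto simp: nn_integral_multc)
  also have "\<dots> \<le> (\<integral>\<^sup>+ t. indicator {0..?h} t * (\<integral>\<^sup>+ \<omega>. ?F t \<omega> \<partial>M) \<partial>lborel)"
  proof (intro nn_integral_mono)
    fix t
    show "indicator {0..?h} t * ennreal (sqrt (real k) / 3 - 1) \<le> indicator {0..?h} t * (\<integral>\<^sup>+ \<omega>. ?F t \<omega> \<partial>M)"
    proof (cases "t \<in> {0..?h}")
      case True
      \<comment> \<open>A window starting in [0, k/n] ends by 2k/n \<le> 1/2, within the time range
        of the truncation estimate.\<close>
      have "?h \<le> 1/4" using k n by (simp add: field_simps)
      moreover have "t \<le> ?h" using True by simp
      ultimately have "t + ?h \<le> 1/2" by linarith
      then show ?thesis using expected_window_excess_ge[OF P k(1), of t] True by simp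
    qed simp
  qed
  also have "\<dots> \<le> (\<integral>\<^sup>+ t. (\<integral>\<^sup>+ \<omega>. ?F t \<omega> \<partial>M) \<partial>lborel)"
    by (intro nn_integral_mono) (auto split: split_indicator)
  \<comment> \<open>Tonelli is applied to the initial window counts only. \<open>A\<close> enters
    afterwards, pointwise in \<omega>, so its measurability is never at issue.\<close>
  also have "\<dots> = (\<integral>\<^sup>+ \<omega>. (\<integral>\<^sup>+ t. ?F t \<omega> \<partial>lborel) \<partial>M)"
    by (intro Fubini') (unfold indicator_def of_bool_def greaterThanAtMost_iff, measurable)
  also have "\<dots> \<le> expected_movement M n X A"
    unfolding expected_movement_def Let_def
  proof (rule nn_integral_mono_AE)
    have "AE \<omega> in M. 0 < X 0 \<omega> \<and> strict_mono (\<lambda>i. X i \<omega>) \<and> filterlim (\<lambda>i. X i \<omega>) at_top sequentially"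
      using P by (auto simp: poisson_arrival_times_def)
    then show "AE \<omega> in M. (\<integral>\<^sup>+ t. ?F t \<omega> \<partial>lborel) \<le> ennreal (total_movement (?xs \<omega>) (A (?xs \<omega>)))"
    proof eventually_elim
      case (elim \<omega>)
      have pos: "0 < X i \<omega>" for i
        using elim strict_mono_mono[of "\<lambda>i. X i \<omega>"] monoD[of "\<lambda>i. X i \<omega>" 0 i] by force
      \<comment> \<open>The properties of \<open>A\<close> are available only on initial placements,
        which the arrivals form almost surely.\<close>
      have "initial_placement n (?xs \<omega>)"
        using elim pos by (auto simp: initial_placement_def sorted_wrt_iff_nth_less strict_mono_def intro: less_imp_le)
      then have "length (A (?xs \<omega>)) = length (?xs \<omega>)" "consecutive_dists_between (1 / real n) v (A (?xs \<omega>))"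
        using S by (auto simp: solves_interference_def displacement_algorithm_def)
      then show ?case
        using total_movement_ge_window_excess[of "A (?xs \<omega>)" "?xs \<omega>" "1 / real n" v k] n by simp
    qed
  qed
  finally show ?thesis .
qed

theorem theorem4:
  shows "\<exists>c>0. \<forall>\<^sub>F n in sequentially.
    \<forall>(M :: 'a measure) X A.
      poisson_arrival_times M (real n) X \<longrightarrow>
      solves_interference n (1 / real n) (1 / real n) A \<longrightarrow>
      ennreal (c * sqrt (real n)) \<le> expected_movement M n X A"
proof (intro exI[of _ "1/144"] conjI)
  show "\<forall>\<^sub>F n in sequentially. \<forall>(M :: 'a measure) X A.
      poisson_arrival_times M (real n) X \<longrightarrow>
      solves_interference n (1 / real n) (1 / real n) A \<longrightarrow>
      ennreal (1/144 * sqrt (real n)) \<le> expected_movement M n X A"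
    \<comment> \<open>324 = 18^2: for sqrt n \<ge> 18 the loss of 1 is at most half of sqrt n /
      9.\<close>
    using eventually_ge_at_top[of 324]
  proof (eventually_elim, intro allI impI)
    fix n :: nat and M :: "'a measure" and X A
    assume n: "324 \<le> n" and P: "poisson_arrival_times M (real n) X"
      and S: "solves_interference n (1 / real n) (1 / real n) A"
    define k where "k = n div 4"
    have k: "1 \<le> k" "4 * k \<le> n" "n \<le> 8 * k" using n by (auto simp: k_def)
    have "sqrt (18 * 18) \<le> sqrt (real n)" using n by (intro real_sqrt_le_mono) simp
    then have n18: "18 \<le> sqrt (real n)" by simp
    \<comment> \<open>The bound n \<le> 8 k is relaxed to 9 k for a rational square root.\<close>
    have "sqrt (real n) \<le> sqrt (3\<^sup>2 * real k)" using k by (intro real_sqrt_le_mono) simp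
    then have "sqrt (real n) \<le> 3 * sqrt (real k)" by (simp add: real_sqrt_mult)
    then have "sqrt (real n) / 18 \<le> sqrt (real k) / 3 - 1" using n18 by simp
    moreover have "1/8 \<le> real k / real n" using k by (simp add: field_simps)
    \<comment> \<open>The range of t contributes the factor 1/8 and the excess 1/18, which gives
      1/144.\<close>
    ultimately have "1/8 * (sqrt (real n) / 18) \<le> real k / real n * (sqrt (real k) / 3 - 1)"
      by (intro mult_mono) auto
    then have "ennreal (1/144 * sqrt (real n)) \<le> ennreal (real k / real n * (sqrt (real k) / 3 - 1))"
      by (intro ennreal_leI) simp
    also have "\<dots> \<le> expected_movement M n X A"
      using P S k by (intro expected_movement_ge)
    finally show "ennreal (1/144 * sqrt (real n)) \<le> expected_movement M n X A" .
  qed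
qed simp

end
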